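(* For all integers $k,n$ with $1\le k<n$, the set of $n$-tuples of integers $(x_1,\dots,x_n)$ with $1\le x_1\le x_2\le\dots\le x_n$ and $\sigma_k(x_1,\dots,x_n)=\sigma_n(x_1,\dots,x_n)$ is finite, and its cardinality $f_k(n)$ satisfies $$1\le f_k(n)<2^{\,n2^{\binom{n}{k}}}.$$
   Context: For $1\le j\le n$, $\sigma_j(x_1,\dots,x_n)=\sum_{1\le i_1<\dots<i_j\le n}x_{i_1}\cdots x_{i_j}$ is the $j$th elementary symmetric polynomial. The exponent in the upper bound is $n\cdot 2^{\binom{n}{k}}$. *)

theory Defs
  imports Complex_Main
begin

text \<open>
  The tuple \<open>(x\<^sub>1, \<dots>, x\<^sub>n)\<close> is a list of length \<open>n\<close> with entries indexed from \<open>0\<close>; the index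
  sequences \<open>i\<^sub>1 < \<dots> < i\<^sub>j\<close> are identified with the \<open>j\<close>-element sets of indices.
\<close>

definition elem_sym :: "nat \<Rightarrow> 'a::comm_semiring_1 list \<Rightarrow> 'a" where
  "elem_sym j xs = (\<Sum>I | I \<subseteq> {..<length xs} \<and> card I = j. \<Prod>i\<in>I. xs ! i)"

definition sym_solutions :: "nat \<Rightarrow> nat \<Rightarrow> int list set" where
  "sym_solutions k n =
     {xs. length xs = n \<and> (\<forall>x\<in>set xs. 1 \<le> x) \<and> sorted xs \<and> elem_sym k xs = elem_sym n xs}"

end

theory Submission
  imports Defs "HOL-Library.Multiset"
begin

text \<open>
  Dividing \<open>\<sigma>\<^sub>k = \<sigma>\<^sub>n\<close> by \<open>x\<^sub>1 \<cdots> x\<^sub>n\<close> writes \<open>1\<close> as a sum of \<open>n choose k\<close> unit fractions whose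
  denominators are the products of \<open>n - k\<close> of the \<open>x\<^sub>i\<close>. The denominators are bounded by Sylvester's
  sequence: among all sums of \<open>m\<close> unit fractions below \<open>1\<close>, the greedy one is the largest. This is
  shown by Soundararajan's argument: a larger sum with denominators \<open>a\<^sub>i\<close> would have a product
  exceeding the product of the Sylvester numbers \<open>s\<^sub>i\<close>, while summation by parts gives
  \<open>\<Sum> a\<^sub>i / s\<^sub>i \<le> m\<close>, which contradicts the inequality of arithmetic and geometric means.

  For existence, the equation is linear in the last unknown, with leading coefficient
  \<open>\<sigma>\<^sub>n\<^sub>-\<^sub>1 - \<sigma>\<^sub>k\<^sub>-\<^sub>1\<close> of the first \<open>n - 1\<close> unknowns; these can be chosen recursively so that this
  coefficient is \<open>1\<close>.
\<close>

section \<open>Sums of unit fractions\<close>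

text \<open>The numbers \<open>sylvester_prod i + 1\<close> form Sylvester's sequence 2, 3, 7, 43, \<dots>\<close>

fun sylvester_prod :: "nat \<Rightarrow> nat" where
  "sylvester_prod 0 = 1"
| "sylvester_prod (Suc n) = sylvester_prod n * (sylvester_prod n + 1)"

lemma sylvester_prod_pos: "sylvester_prod n > 0"
  by (induction n) auto

lemma prod_sylvester: "(\<Prod>i<n. sylvester_prod i + 1) = sylvester_prod n"
  by (induction n) auto

text \<open>Telescoping: \<open>1 / (s + 1) = 1 / s - 1 / (s * (s + 1))\<close> with
  \<open>s = sylvester_prod i\<close>.\<close>

lemma sum_inverse_sylvester:
  "(\<Sum>i<n. 1 / (real (sylvester_prod i) + 1)) = 1 - 1 / real (sylvester_prod n)"
proof (induction n)
  case (Suc n)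
  have "1 - 1 / s + 1 / (s + 1) = 1 - 1 / (s * (s + 1))" if "s > 0" for s :: real
  proof -
    have "s * (s + 1) > 0" using that by simp
    then show ?thesis using that by (simp add: divide_simps) algebra
  qed
  from this[of "real (sylvester_prod n)"] show ?case
    using Suc sylvester_prod_pos[of n] by (simp add: algebra_simps)
qed simp

lemma sylvester_prod_less: "sylvester_prod n < 2 ^ 2 ^ n"
proof (induction n)
  case (Suc n)
  let ?s = "sylvester_prod n"
  have "sylvester_prod (Suc n) < (?s + 1) * (?s + 1)" by simp
  also have "\<dots> \<le> 2 ^ 2 ^ n * 2 ^ 2 ^ n" using Suc by (intro mult_mono) auto
  also have "\<dots> = 2 ^ 2 ^ Suc n" by (simp add: mult_2 flip: power_add)
  finally show ?case .
qed simp

lemma sum_inverse_eq_fraction: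
  fixes a :: "nat \<Rightarrow> nat"
  assumes "\<And>i. i < n \<Longrightarrow> a i > 0"
  shows "\<exists>N::nat. (\<Sum>i<n. 1 / real (a i)) = real N / real (\<Prod>i<n. a i)"
  using assms
proof (induction n)
  case (Suc n)
  then obtain N where N: "(\<Sum>i<n. 1 / real (a i)) = real N / real (\<Prod>i<n. a i)"
    by auto
  have "(\<Prod>i<n. a i) > 0" "a n > 0" using Suc.prems by (auto intro!: prod_pos)
  then have "(\<Sum>i<Suc n. 1 / real (a i)) =
      real (N * a n + (\<Prod>i<n. a i)) / real (\<Prod>i<Suc n. a i)"
    using N by (simp add: add_divide_distrib del: of_nat_prod)
  then show ?case by blast
qed (auto intro: exI[of _ 0])

text \<open>Over the common denominator \<open>\<Prod>i<n. a i\<close> the numerator is an integer,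
  so a sum below 1 misses 1 by at least one unit of that denominator.\<close>

lemma sum_inverse_gap:
  fixes a :: "nat \<Rightarrow> nat"
  assumes "\<And>i. i < n \<Longrightarrow> a i > 0" and "(\<Sum>i<n. 1 / real (a i)) < 1"
  shows "(\<Sum>i<n. 1 / real (a i)) \<le> 1 - 1 / real (\<Prod>i<n. a i)"
proof -
  obtain N where N: "(\<Sum>i<n. 1 / real (a i)) = real N / real (\<Prod>i<n. a i)"
    using sum_inverse_eq_fraction assms(1) by blast
  define P where "P = (\<Prod>i<n. a i)"
  have P: "P > 0" unfolding P_def using assms(1) by (auto intro!: prod_pos)
  have "real N / real P < 1" using assms(2) unfolding N P_def .
  then have "N < P" using P by simp
  then have "real N + 1 \<le> real P" by linarith
  then show ?thesis using P unfolding N P_def[symmetric] by (simp add: field_simps)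
qed

text \<open>Summation by parts: raising the weight on a nonpositive prefix sum only lowers the
  product. The sign condition concerns proper prefixes; the full sum of \<open>d\<close> may be
  positive, as it is in the application.\<close>

lemma abel_sum_lower_bound:
  fixes a d :: "nat \<Rightarrow> real"
  assumes "\<And>i j. i \<le> j \<Longrightarrow> j \<le> n \<Longrightarrow> a i \<le> a j"
    and "\<And>m. m \<le> n \<Longrightarrow> (\<Sum>i<m. d i) \<le> 0"
  shows "a n * (\<Sum>i<Suc n. d i) \<le> (\<Sum>i<Suc n. a i * d i)"
  using assms
proof (induction n)
  case (Suc n)
  have "a n * (\<Sum>i<Suc n. d i) \<le> (\<Sum>i<Suc n. a i * d i)"
    using Suc.prems by (intro Suc.IH) auto
  moreover have "a (Suc n) * (\<Sum>i<Suc n. d i) \<le> a n * (\<Sum>i<Suc n. d i)"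
    by (intro mult_right_mono_neg Suc.prems) auto
  ultimately show ?case
    by (simp only: sum.lessThan_Suc[of _ "Suc n"] distrib_left)
qed simp

text \<open>By strong induction the shorter cases control every proper prefix, so a counterexample
  overtakes the Sylvester sum only with its last term.\<close>

lemma sum_inverse_le_sylvester_sorted:
  fixes a :: "nat \<Rightarrow> nat"
  assumes "\<And>i. i < n \<Longrightarrow> a i > 0" and "\<And>i j. i \<le> j \<Longrightarrow> j < n \<Longrightarrow> a i \<le> a j"
    and "(\<Sum>i<n. 1 / real (a i)) < 1"
  shows "(\<Sum>i<n. 1 / real (a i)) \<le> 1 - 1 / real (sylvester_prod n)"
  using assms
proof (induction n rule: less_induct)
  case (less n)
  define s where "s i = real (sylvester_prod i) + 1" for i
  define d where "d i = 1 / real (a i) - 1 / s i" for i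
  have s_pos: "s i > 0" for i by (simp add: s_def)
  have sum_s: "(\<Sum>i<m. 1 / s i) = 1 - 1 / real (sylvester_prod m)" for m
    using sum_inverse_sylvester by (simp add: s_def)
  have prod_s: "(\<Prod>i<n. s i) = real (sylvester_prod n)"
    using arg_cong[OF prod_sylvester, of real n] by (simp add: s_def add.commute)
  have prefix: "(\<Sum>i<m. d i) \<le> 0" if "m < n" for m
  proof -
    have "(\<Sum>i<m. 1 / real (a i)) \<le> (\<Sum>i<n. 1 / real (a i))"
      using that by (intro sum_mono2) auto
    then have "(\<Sum>i<m. 1 / real (a i)) \<le> 1 - 1 / real (sylvester_prod m)"
      using that less.prems by (intro less.IH) auto
    then show ?thesis by (simp add: d_def sum_subtractf sum_s)
  qed
  show ?case
  proof (rule ccontr)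
    assume larger: "\<not> ?thesis"
    then have "n > 0" by (cases n) auto
    then obtain m where m: "n = Suc m" by (cases n) auto
    have "0 \<le> real (a m) * (\<Sum>i<Suc m. d i)"
      using larger unfolding m by (simp add: d_def sum_subtractf sum_s del: sum.lessThan_Suc)
    also have "\<dots> \<le> (\<Sum>i<Suc m. real (a i) * d i)"
      using less.prems(2) prefix m by (intro abel_sum_lower_bound) auto
    \<comment> \<open>Weighting \<open>d i\<close> by \<open>a i\<close> leaves quotients
      \<open>a i / s i\<close> whose sum is thus at most \<open>n\<close>.\<close>
    also have "\<dots> = (\<Sum>i<n. 1 - real (a i) / s i)"
      unfolding m using less.prems(1) m
      by (intro sum.cong) (auto simp: d_def right_diff_distrib)
    finally have 1: "(\<Sum>i<n. real (a i) / s i - 1) \<le> 0"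
      by (simp add: sum_subtractf)
    define P where "P = (\<Prod>i<n. a i)"
    \<comment> \<open>The gap below 1 is at least \<open>1 / P\<close> but less than
      \<open>1 / sylvester_prod n\<close>, which forces \<open>P\<close> above the Sylvester
      product.\<close>
    have "(\<Sum>i<n. 1 / real (a i)) \<le> 1 - 1 / real P"
      unfolding P_def using less.prems by (intro sum_inverse_gap) auto
    then have "1 / real P < 1 / real (sylvester_prod n)" using larger by linarith
    moreover have "P > 0" unfolding P_def using less.prems(1) by (auto intro!: prod_pos)
    ultimately have "real (sylvester_prod n) < real P"
      using sylvester_prod_pos[of n] by (simp add: divide_simps split: if_splits)
    then have "real (sylvester_prod n) < (\<Prod>i<n. real (a i))" unfolding P_def by simp
    then have "0 < ln ((\<Prod>i<n. real (a i)) / (\<Prod>i<n. s i))"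
      using sylvester_prod_pos[of n] unfolding prod_s by (intro ln_gt_zero) simp
    also have "\<dots> = (\<Sum>i<n. ln (real (a i) / s i))"
      using less.prems(1) s_pos unfolding prod_dividef[symmetric]
      by (intro ln_prod) (auto simp: less_imp_neq[THEN not_sym])
    \<comment> \<open>The bound \<open>ln y \<le> y - 1\<close> stands in for the inequality of
      arithmetic and geometric means.\<close>
    also have "\<dots> \<le> (\<Sum>i<n. real (a i) / s i - 1)"
      using less.prems(1) s_pos by (intro sum_mono ln_le_minus_one) auto
    finally show False using 1 by simp
  qed
qed

text \<open>Sorting the values of \<open>p\<close> into a list keeps their multiset, hence the sum,
  and reduces to the sorted case.\<close>

lemma sum_inverse_le_sylvester:
  fixes p :: "'a \<Rightarrow> nat"
  assumes "finite S" and "\<And>s. s \<in> S \<Longrightarrow> p s > 0" and "(\<Sum>s\<in>S. 1 / real (p s)) < 1"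
  shows "(\<Sum>s\<in>S. 1 / real (p s)) \<le> 1 - 1 / real (sylvester_prod (card S))"
proof -
  obtain xs where xs: "set xs = S" "distinct xs"
    using finite_distinct_list assms(1) by blast
  define l where "l = sort (map p xs)"
  have len: "length l = card S" using xs distinct_card by (fastforce simp: l_def)
  have "(\<Sum>s\<in>S. 1 / real (p s)) = sum_list (map (\<lambda>x. 1 / real x) (map p xs))"
    using xs by (simp add: sum_list_distinct_conv_sum_set o_def)
  also have "\<dots> = sum_list (map (\<lambda>x. 1 / real x) l)"
    by (simp add: l_def multiset.map_comp flip: sum_mset_sum_list)
  also have "\<dots> = (\<Sum>i<card S. 1 / real (l ! i))"
    by (simp add: sum_list_sum_nth len atLeast0LessThan)
  finally have eq: "(\<Sum>s\<in>S. 1 / real (p s)) = (\<Sum>i<card S. 1 / real (l ! i))" .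
  have "l ! i > 0" if "i < card S" for i
    using nth_mem[of i l] that assms(2) xs unfolding len by (auto simp: l_def)
  moreover have "l ! i \<le> l ! j" if "i \<le> j" "j < card S" for i j
    using that len by (intro sorted_nth_mono) (auto simp: l_def)
  ultimately show ?thesis
    using assms(3) unfolding eq by (intro sum_inverse_le_sylvester_sorted)
qed

text \<open>Dropping \<open>t\<close> leaves \<open>card S - 1\<close> unit fractions with sum
  \<open>1 - 1 / p t\<close>, below 1, to which the Sylvester bound applies.\<close>

lemma unit_fraction_denominator_le:
  fixes p :: "'a \<Rightarrow> nat"
  assumes "finite S" and "\<And>s. s \<in> S \<Longrightarrow> p s > 0" and "(\<Sum>s\<in>S. 1 / real (p s)) = 1"
    and "t \<in> S"
  shows "p t \<le> sylvester_prod (card S - 1)"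
proof -
  have split: "(\<Sum>s\<in>S. 1 / real (p s)) = 1 / real (p t) + (\<Sum>s\<in>S - {t}. 1 / real (p s))"
    using assms by (simp add: sum.remove)
  have pt: "p t > 0" using assms by blast
  then have "1 / real (p t) > 0" by simp
  then have "(\<Sum>s\<in>S - {t}. 1 / real (p s)) < 1" using split assms(3) by linarith
  then have "(\<Sum>s\<in>S - {t}. 1 / real (p s)) \<le> 1 - 1 / real (sylvester_prod (card (S - {t})))"
    using assms by (intro sum_inverse_le_sylvester) auto
  then have "1 / real (sylvester_prod (card S - 1)) \<le> 1 / real (p t)"
    using split assms by simp
  then show ?thesis
    using pt sylvester_prod_pos[of "card S - 1"] by (simp add: divide_simps)
qed

section \<open>Elementary symmetric polynomials\<close>

lemma finite_index_sets [simp]: "finite {I. I \<subseteq> {..<n::nat} \<and> card I = j}"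
  by (rule finite_subset[of _ "Pow {..<n}"]) auto

lemma elem_sym_0: "elem_sym 0 xs = 1"
proof -
  have "{I. I \<subseteq> {..<length xs} \<and> card I = 0} = {{}}"
    by (auto simp: card_eq_0_iff dest: finite_subset[OF _ finite_lessThan])
  then show ?thesis by (simp add: elem_sym_def)
qed

lemma elem_sym_eq_0:
  assumes "length xs < j"
  shows "elem_sym j xs = 0"
proof -
  have "card I \<noteq> j" if "I \<subseteq> {..<length xs}" for I
    using card_mono[OF _ that] assms by auto
  then have "{I. I \<subseteq> {..<length xs} \<and> card I = j} = {}" by auto
  then show ?thesis unfolding elem_sym_def by (simp only: sum.empty)
qed

lemma index_sets_Suc:
  "{I. I \<subseteq> {..<Suc n} \<and> card I = Suc j} =
   {I. I \<subseteq> {..<n} \<and> card I = Suc j} \<union> insert n ` {I. I \<subseteq> {..<n} \<and> card I = j}"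
  (is "?L = ?R")
proof (intro subset_antisym subsetI)
  fix I assume I: "I \<in> ?L"
  then have fin: "finite I" by (auto dest: finite_subset)
  show "I \<in> ?R"
  proof (cases "n \<in> I")
    case True
    then have "I = insert n (I - {n})" "card (I - {n}) = j" "I - {n} \<subseteq> {..<n}"
      using I fin by (auto simp: less_Suc_eq)
    then show ?thesis by blast
  next
    case False
    then show ?thesis using I by (auto simp: less_Suc_eq)
  qed
next
  fix I assume "I \<in> ?R"
  moreover have "card (insert n J) = Suc (card J)" if "J \<subseteq> {..<n}" for J
    using that finite_subset[OF that] by (subst card_insert_disjoint) auto
  ultimately show "I \<in> ?L" by (auto simp: less_Suc_eq)
qed

text \<open>Index sets are split by whether they contain the last index. This exposes the linearity
  in the last entry.\<close>

lemma elem_sym_snoc: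
  "elem_sym (Suc j) (xs @ [x]) = elem_sym (Suc j) xs + x * elem_sym j xs"
proof -
  define n where "n = length xs"
  let ?S = "\<lambda>j. {I. I \<subseteq> {..<n} \<and> card I = j}"
  let ?f = "\<lambda>I. \<Prod>i\<in>I. (xs @ [x]) ! i"
  have old: "?f I = (\<Prod>i\<in>I. xs ! i)" if "I \<subseteq> {..<n}" for I
    using that by (intro prod.cong) (auto simp: nth_append n_def)
  have new: "?f (insert n I) = x * (\<Prod>i\<in>I. xs ! i)" if "I \<subseteq> {..<n}" for I
    using that finite_subset[OF that] old[OF that]
    by (subst prod.insert) (auto simp: nth_append n_def)
  have inj: "inj_on (insert n) (?S j)"
    by (rule inj_onI) (metis (no_types, lifting) insert_ident lessThan_iff less_irrefl mem_Collect_eq subsetD)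
  have "elem_sym (Suc j) (xs @ [x]) = sum ?f (?S (Suc j) \<union> insert n ` ?S j)"
    unfolding index_sets_Suc[symmetric] by (simp add: elem_sym_def n_def)
  also have "\<dots> = sum ?f (?S (Suc j)) + sum ?f (insert n ` ?S j)"
    by (intro sum.union_disjoint) auto
  also have "sum ?f (insert n ` ?S j) = (\<Sum>I\<in>?S j. x * (\<Prod>i\<in>I. xs ! i))"
    using new by (simp add: sum.reindex[OF inj] del: insert_iff)
  also have "sum ?f (?S (Suc j)) = (\<Sum>I\<in>?S (Suc j). \<Prod>i\<in>I. xs ! i)"
    using old by (intro sum.cong) auto
  finally show ?thesis by (simp add: elem_sym_def n_def sum_distrib_left)
qed

lemma elem_sym_length: "elem_sym (length xs) xs = (\<Prod>i<length xs. xs ! i)"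
proof -
  have "{I. I \<subseteq> {..<length xs} \<and> card I = length xs} = {{..<length xs}}"
    using card_subset_eq[of "{..<length xs}"] by auto
  then show ?thesis by (simp add: elem_sym_def)
qed

text \<open>Some monomial of degree \<open>j\<close> contains \<open>x\<close>, and its other
  factors are at least 1. The bound later shows that an appended entry is the largest.\<close>

lemma le_elem_sym:
  fixes xs :: "int list"
  assumes "\<forall>x\<in>set xs. 1 \<le> x" and "x \<in> set xs" and "1 \<le> j" and "j \<le> length xs"
  shows "x \<le> elem_sym j xs"
proof -
  obtain i where i: "i < length xs" "x = xs ! i" using assms(2) by (auto simp: in_set_conv_nth)
  have ge: "xs ! l \<ge> 1" if "l < length xs" for l using assms(1) that by simp
  have "j - 1 \<le> card ({..<length xs} - {i})" using i assms by simp
  then obtain J where J: "J \<subseteq> {..<length xs} - {i}" "card J = j - 1" "finite J"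
    by (rule obtain_subset_with_card_n)
  have I: "insert i J \<subseteq> {..<length xs}" "card (insert i J) = j"
    using J i assms(3) by (auto simp: card_insert_if)
  have "1 \<le> (\<Prod>l\<in>J. xs ! l)" using J ge by (intro prod_ge_1) auto
  then have "x * 1 \<le> x * (\<Prod>l\<in>J. xs ! l)"
    using i ge[of i] by (intro mult_left_mono) auto
  also have "\<dots> = (\<Prod>l\<in>insert i J. xs ! l)" using J i by (subst prod.insert) auto
  also have "\<dots> \<le> elem_sym j xs"
    unfolding elem_sym_def
  proof (rule member_le_sum)
    fix I assume "I \<in> {I. I \<subseteq> {..<length xs} \<and> card I = j} - {insert i J}"
    then show "0 \<le> (\<Prod>l\<in>I. xs ! l)" using ge by (intro prod_nonneg) force
  qed (use I in auto)
  finally show ?thesis by simp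
qed

lemma sorted_snoc_ge:
  fixes xs :: "'a::linorder list"
  assumes "sorted xs" and "\<forall>x\<in>set xs. x \<le> y"
  shows "sorted (xs @ [y])"
  using assms by (simp add: sorted_append)

section \<open>Existence of solutions\<close>

text \<open>With \<open>j = k - 1\<close> and \<open>d = n - k\<close> this supplies the first
  \<open>n - 1\<close> unknowns; \<open>d\<close> stays fixed while \<open>j\<close> grows by
  appending entries.\<close>

lemma exists_elem_sym_diff_one:
  assumes "1 \<le> d"
  shows "\<exists>xs::int list. length xs = j + d \<and> (\<forall>x\<in>set xs. 1 \<le> x) \<and> sorted xs \<and>
           elem_sym (j + d) xs = elem_sym j xs + 1"
proof (induction j)
  case 0
  obtain e where e: "d = Suc e" using assms by (cases d) auto
  let ?xs = "replicate e 1 @ [2] :: int list"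
  have "elem_sym (length (replicate e 1)) (replicate e 1 :: int list) = 1"
    using elem_sym_length[of "replicate e (1::int)"] by simp
  then have "elem_sym (Suc e) ?xs = 2"
    by (simp add: elem_sym_snoc elem_sym_eq_0)
  then have "elem_sym (0 + d) ?xs = elem_sym 0 ?xs + 1"
    by (simp add: e elem_sym_0)
  moreover have "sorted ?xs" by (simp add: sorted_append)
  ultimately show ?case by (intro exI[of _ ?xs]) (auto simp: e)
next
  case (Suc j)
  then obtain xs :: "int list" where len: "length xs = j + d"
    and xs: "\<forall>x\<in>set xs. 1 \<le> x" "sorted xs" "elem_sym (j + d) xs = elem_sym j xs + 1"
    by blast
  \<comment> \<open>As \<open>elem_sym (Suc j + d) xs = 0\<close> by length, the new difference is
    \<open>t * (elem_sym (j + d) xs - elem_sym j xs) - elem_sym (Suc j) xs\<close>, that is,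
    \<open>t - elem_sym (Suc j) xs\<close>.\<close>
  define t where "t = elem_sym (Suc j) xs + 1"
  have le: "\<forall>x\<in>set xs. x \<le> t"
    using le_elem_sym[OF xs(1), of _ "Suc j"] len assms by (force simp: t_def)
  moreover have "xs \<noteq> []" using len assms by auto
  ultimately have "1 \<le> t" using xs(1) by (metis hd_in_set order_trans)
  moreover have "sorted (xs @ [t])" using xs(2) le by (rule sorted_snoc_ge)
  moreover have "elem_sym (Suc j + d) (xs @ [t]) = elem_sym (Suc j) (xs @ [t]) + 1"
    using xs(3) len by (simp add: elem_sym_snoc elem_sym_eq_0 t_def algebra_simps)
  ultimately show ?case using xs(1) len by (intro exI[of _ "xs @ [t]"]) auto
qed

lemma sym_solutions_nonempty:
  assumes "1 \<le> k" and "k < n"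
  shows "sym_solutions k n \<noteq> {}"
proof -
  obtain j where j: "k = Suc j" using assms by (cases k) auto
  define d where "d = n - k"
  have d: "1 \<le> d" "n = Suc (j + d)" using assms j by (auto simp: d_def)
  obtain xs :: "int list" where len: "length xs = j + d"
    and xs: "\<forall>x\<in>set xs. 1 \<le> x" "sorted xs" "elem_sym (j + d) xs = elem_sym j xs + 1"
    using exists_elem_sym_diff_one[OF d(1)] by blast
  \<comment> \<open>The equation for a last entry \<open>t\<close> is \<open>elem_sym k xs + t *
    elem_sym (k - 1) xs = t * elem_sym (n - 1) xs\<close>, whose two coefficients of
    \<open>t\<close> differ by 1.\<close>
  define t where "t = elem_sym k xs"
  have le: "\<forall>x\<in>set xs. x \<le> t"
    using le_elem_sym[OF xs(1), of _ k] len j d by (force simp: t_def)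
  moreover have "xs \<noteq> []" using len d by auto
  ultimately have "1 \<le> t" using xs(1) by (metis hd_in_set order_trans)
  moreover have "sorted (xs @ [t])" using xs(2) le by (rule sorted_snoc_ge)
  moreover have "elem_sym k (xs @ [t]) = elem_sym n (xs @ [t])"
    using xs(3) len by (simp add: elem_sym_snoc elem_sym_eq_0 t_def j d(2) algebra_simps)
  ultimately have "xs @ [t] \<in> sym_solutions k n"
    using xs(1) len d by (auto simp: sym_solutions_def)
  then show ?thesis by blast
qed

section \<open>The upper bound\<close>

lemma sym_solutions_entry_le:
  assumes "k < n" and "xs \<in> sym_solutions k n" and "x \<in> set xs"
  shows "x \<le> int (sylvester_prod ((n choose k) - 1))"
proof -
  have len: "length xs = n" and ge1: "\<forall>x\<in>set xs. 1 \<le> x"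
    and eq: "elem_sym k xs = elem_sym n xs"
    using assms(2) by (auto simp: sym_solutions_def)
  have ge: "xs ! i \<ge> 1" if "i < n" for i using ge1 len that by simp
  define S where "S = {I. I \<subseteq> {..<n} \<and> card I = k}"
  \<comment> \<open>The complementary product is the denominator left when the monomial of
    \<open>I\<close> is divided by the product of all entries.\<close>
  define p where "p I = nat (\<Prod>i\<in>{..<n} - I. xs ! i)" for I
  have prod_ge: "(\<Prod>i\<in>A. xs ! i) \<ge> 1" if "A \<subseteq> {..<n}" for A
    using that ge by (intro prod_ge_1) auto
  have p_int: "int (p I) = (\<Prod>i\<in>{..<n} - I. xs ! i)" for I
    using prod_ge[of "{..<n} - I"] by (auto simp: p_def)
  have p_pos: "p I > 0" for I
    using prod_ge[of "{..<n} - I"] by (auto simp: p_def)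
  define P where "P = (\<Prod>i<n. xs ! i)"
  have P: "P \<ge> 1" unfolding P_def by (rule prod_ge) simp
  have term_eq: "1 / real (p I) = real_of_int (\<Prod>i\<in>I. xs ! i) / real_of_int P" if "I \<in> S" for I
  proof -
    have "P = (\<Prod>i\<in>{..<n} - I. xs ! i) * (\<Prod>i\<in>I. xs ! i)"
      unfolding P_def using that by (intro prod.subset_diff) (auto simp: S_def)
    then have "real_of_int P = real (p I) * real_of_int (\<Prod>i\<in>I. xs ! i)"
      by (metis p_int of_int_mult of_int_of_nat_eq)
    then show ?thesis using p_pos[of I] P by (auto simp: divide_simps)
  qed
  have "(\<Sum>I\<in>S. 1 / real (p I)) = real_of_int (\<Sum>I\<in>S. \<Prod>i\<in>I. xs ! i) / real_of_int P"
    using term_eq by (simp add: sum_divide_distrib)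
  also have "(\<Sum>I\<in>S. \<Prod>i\<in>I. xs ! i) = P"
    using eq elem_sym_length[of xs] len by (simp add: elem_sym_def S_def P_def)
  finally have sum1: "(\<Sum>I\<in>S. 1 / real (p I)) = 1" using P by simp
  obtain i where i: "i < n" "x = xs ! i" using assms(3) len by (auto simp: in_set_conv_nth)
  \<comment> \<open>Since \<open>k < n\<close>, some index set \<open>I\<close> of size
    \<open>k\<close> avoids \<open>i\<close>; then \<open>x\<close> is a factor of
    \<open>p I\<close>.\<close>
  have "k \<le> card ({..<n} - {i})" using i assms(1) by simp
  then obtain I where I: "I \<subseteq> {..<n} - {i}" "card I = k" "finite I"
    by (rule obtain_subset_with_card_n)
  then have "I \<in> S" by (auto simp: S_def)
  moreover have "finite S" by (simp add: S_def)
  ultimately have "p I \<le> sylvester_prod (card S - 1)"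
    using sum1 p_pos by (intro unit_fraction_denominator_le) auto
  moreover have "card S = n choose k" by (simp add: S_def n_subsets)
  moreover have "x \<le> int (p I)"
  proof -
    have "(\<Prod>l\<in>{..<n} - I. xs ! l) = x * (\<Prod>l\<in>{..<n} - I - {i}. xs ! l)"
      using i I by (subst prod.remove[of _ i]) auto
    moreover have "x * 1 \<le> x * (\<Prod>l\<in>{..<n} - I - {i}. xs ! l)"
      using i ge[of i] by (intro mult_left_mono prod_ge) auto
    ultimately show ?thesis by (simp add: p_int)
  qed
  ultimately show ?thesis by simp
qed

theorem theorem1:
  fixes k n :: nat
  assumes "1 \<le> k" and "k < n"
  shows "finite (sym_solutions k n) \<and>
         1 \<le> card (sym_solutions k n) \<and>
         card (sym_solutions k n) < 2 ^ (n * 2 ^ (n choose k))"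
proof -
  define B where "B = sylvester_prod ((n choose k) - 1)"
  \<comment> \<open>Sortedness is given up here: counting all lists with bounded entries is
    enough.\<close>
  let ?L = "{xs. set xs \<subseteq> {1..int B} \<and> length xs = n}"
  have sub: "sym_solutions k n \<subseteq> ?L"
    using sym_solutions_entry_le[OF assms(2)] by (auto simp: B_def) (auto simp: sym_solutions_def)
  have fin: "finite ?L" by (rule finite_lists_length_eq) simp
  then have "finite (sym_solutions k n)" using sub by (rule finite_subset[rotated])
  moreover from this have "1 \<le> card (sym_solutions k n)"
    using sym_solutions_nonempty[OF assms] by (simp add: Suc_le_eq card_gt_0_iff)
  moreover have "card (sym_solutions k n) < 2 ^ (n * 2 ^ (n choose k))"
  proof -
    have "B < 2 ^ 2 ^ ((n choose k) - 1)" unfolding B_def by (rule sylvester_prod_less)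
    also have "\<dots> \<le> 2 ^ 2 ^ (n choose k)" by (intro power_increasing) auto
    finally have "B ^ n < (2 ^ 2 ^ (n choose k)) ^ n"
      \<comment> \<open>Strictness survives the power because \<open>k < n\<close> gives
        \<open>n > 0\<close>.\<close>
      using assms by (intro power_strict_mono) auto
    moreover have "card (sym_solutions k n) \<le> card ?L" using fin sub by (rule card_mono)
    moreover have "card ?L = B ^ n" by (subst card_lists_length_eq) auto
    ultimately show ?thesis by (simp add: power_mult[symmetric] mult.commute)
  qed
  ultimately show ?thesis by blast
qed

end
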